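(* Let $k=\mathbb{C}$ and let $f_1,\dots,f_r\in k[X_1,\dots,X_n]$. If the alphabet $\{\sqrt{f_1},\dots,\sqrt{f_r}\}$ is rationalizable, then for every non-empty subset $J\subseteq\{1,\dots,r\}$ the square root $$\sqrt{\prod_{j\in J} f_j}$$ is rationalizable.
   Context: Let $Q=k(X_1,\dots,X_n)$ with $k=\mathbb{C}$. For $g\in Q$, the square root $\sqrt{g}$ is called rationalizable if there is a (unital) homomorphism of $k$-algebras $\phi\colon Q\to Q$ such that $\phi(g)$ is a square in $Q$. For polynomials $f_1,\dots,f_r\in k[X_1,\dots,X_n]$, the set of square roots (called an alphabet) $\{\sqrt{f_1},\dots,\sqrt{f_r}\}$ is called rationalizable if there is a single homomorphism of $k$-algebras $\phi\colon Q\to Q$ such that for every $i=1,\dots,r$ one has $\phi(f_i)=h_i^2$ for some $h_i\in Q$. *)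

theory Defs
  imports
    Complex_Main
    "HOL-Library.Poly_Mapping"
    "HOL-Computational_Algebra.Polynomial_Factorial"
begin

text \<open>
  The \<open>n\<close> indeterminates are the elements of a finite index type \<open>'n\<close>, with \<open>n = CARD('n)\<close>; a
  monomial is its exponent vector. The class \<open>linorder\<close> on \<open>'n\<close> only serves to obtain the library's
  instance of class \<open>idom\<close> for the polynomial ring, which is required to form its fraction field;
  no definition below refers to the order.
\<close>

type_synonym 'n mpoly = "('n \<Rightarrow>\<^sub>0 nat) \<Rightarrow>\<^sub>0 complex"

type_synonym 'n ratfun = "'n mpoly fract"

definition scalar :: "complex \<Rightarrow> 'n::{finite,linorder} ratfun" where
  "scalar c = to_fract (Poly_Mapping.single 0 c)"

definition algebra_hom :: "('n::{finite,linorder} ratfun \<Rightarrow> 'n ratfun) \<Rightarrow> bool" where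
  "algebra_hom \<phi> \<longleftrightarrow>
     \<phi> 1 = 1 \<and>
     (\<forall>g h. \<phi> (g + h) = \<phi> g + \<phi> h) \<and>
     (\<forall>g h. \<phi> (g * h) = \<phi> g * \<phi> h) \<and>
     (\<forall>c g. \<phi> (scalar c * g) = scalar c * \<phi> g)"

text \<open>
  Rationalizability is a property of the radicand \<open>g\<close> (respectively of the radicands \<open>f i\<close>): no
  square root is actually formed.
\<close>

definition sqrt_rationalizable :: "'n::{finite,linorder} ratfun \<Rightarrow> bool" where
  "sqrt_rationalizable g \<longleftrightarrow> (\<exists>\<phi>. algebra_hom \<phi> \<and> (\<exists>h. \<phi> g = h\<^sup>2))"

definition alphabet_rationalizable :: "nat \<Rightarrow> (nat \<Rightarrow> 'n::{finite,linorder} mpoly) \<Rightarrow> bool" where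
  "alphabet_rationalizable r f \<longleftrightarrow>
     (\<exists>\<phi>. algebra_hom \<phi> \<and> (\<forall>i\<in>{1..r}. \<exists>h. \<phi> (to_fract (f i)) = h\<^sup>2))"

end

theory Submission
  imports Defs
begin

text \<open>
  A map that makes every \<open>f i\<close> a square makes every product of the \<open>f i\<close> a square: it is
  multiplicative, and a product of squares is the square of the product of the roots. Hence the
  homomorphism that rationalizes the alphabet serves for all subsets \<open>J\<close> at once.
\<close>

lemma to_fract_prod: "to_fract (\<Prod>j\<in>J. f j) = (\<Prod>j\<in>J. to_fract (f j))"
  by (induction J rule: infinite_finite_induct) simp_all

lemma algebra_hom_prod:
  assumes "algebra_hom \<phi>"
  shows "\<phi> (\<Prod>j\<in>J. g j) = (\<Prod>j\<in>J. \<phi> (g j))"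
proof -
  have "\<phi> 1 = 1" and "\<And>a b. \<phi> (a * b) = \<phi> a * \<phi> b"
    using assms by (simp_all add: algebra_hom_def)
  then show ?thesis
    by (induction J rule: infinite_finite_induct) simp_all
qed

theorem proposition47:
  fixes r :: nat and f :: "nat \<Rightarrow> 'n::{finite,linorder} mpoly"
  assumes "alphabet_rationalizable r f"
  shows "\<forall>J. J \<subseteq> {1..r} \<and> J \<noteq> {} \<longrightarrow> sqrt_rationalizable (to_fract (\<Prod>j\<in>J. f j))"
proof (intro allI impI)
  fix J
  assume J: "J \<subseteq> {1..r} \<and> J \<noteq> {}"
  obtain \<phi> h where hom: "algebra_hom \<phi>"
    and h: "\<And>i. i \<in> {1..r} \<Longrightarrow> \<phi> (to_fract (f i)) = (h i)\<^sup>2"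
    using assms unfolding alphabet_rationalizable_def by metis
  have "\<phi> (to_fract (\<Prod>j\<in>J. f j)) = (\<Prod>j\<in>J. \<phi> (to_fract (f j)))"
    by (simp add: to_fract_prod algebra_hom_prod[OF hom])
  also have "\<dots> = (\<Prod>j\<in>J. (h j)\<^sup>2)"
    using J by (intro prod.cong refl h) blast
  also have "\<dots> = (\<Prod>j\<in>J. h j)\<^sup>2"
    by (rule prod_power_distrib[symmetric])
  finally show "sqrt_rationalizable (to_fract (\<Prod>j\<in>J. f j))"
    unfolding sqrt_rationalizable_def using hom by blast
qed

end
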